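(* Let $p\in\mathbb{N}$, $b\in\mathbb{C}\setminus\{0\}$, $a\in\mathbb{C}\setminus\{0\}$, $0\le\alpha<1$, $-\frac{\pi}{2}<\lambda<\frac{\pi}{2}$, and suppose that $2pab(1-\alpha)e^{-i\lambda}\cos\lambda\in\mathbf{B}$. If $f\in\mathcal{S}_p^{\lambda}(\alpha,b)$, then $$\left[\frac{f(z)}{z^p}\right]^{a}\prec\frac{1}{(1-z)^{2pab(1-\alpha)e^{-i\lambda}\cos\lambda}}\qquad(z\in\mathbb{U});$$ equivalently, for $f\in\mathcal{A}_p$, $$1+\frac{e^{i\lambda}}{b\cos\lambda}\left[\frac{zf'(z)}{pf(z)}-1\right]\prec\frac{1+(1-2\alpha)z}{1-z}\ \Longrightarrow\ \left[\frac{f(z)}{z^p}\right]^{a}\prec\frac{1}{(1-z)^{2pab(1-\alpha)e^{-i\lambda}\cos\lambda}}.$$ Moreover $q(z)=(1-z)^{-2pab(1-\alpha)e^{-i\lambda}\cos\lambda}$ is the best dominant.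
   Context: $\mathbb{U}=\{z\in\mathbb{C}:|z|<1\}$. $\mathcal{A}_p$ is the class of analytic functions on $\mathbb{U}$ of the form $f(z)=z^p+\sum_{k=p+1}^\infty a_kz^k$. For $g,h$ analytic in $\mathbb{U}$, $g\prec h$ means $g=h\circ\omega$ for some analytic $\omega:\mathbb{U}\to\mathbb{U}$ with $\omega(0)=0$. $\mathbf{B}=\{z\in\mathbb{C}:|z+1|\le1\text{ or }|z-1|\le1\}$. All powers are principal, i.e. the analytic branches with value $1$ at $z=0$ ($f(z)/z^p$ being given the value $1$ at $z=0$). $\mathcal{S}_p^{\lambda}(\alpha,b)$ is the class of $f\in\mathcal{A}_p$ such that, for $z\in\mathbb{U}$, $$\operatorname{Re}\left(\frac{1}{b\cos\lambda}\left[e^{i\lambda}\frac{zf'(z)}{pf(z)}-(1-b)\cos\lambda-i\sin\lambda\right]\right)>\alpha.$$ Best dominant: for a first-order differential subordination $\psi(\mathfrak{p}(z),z\mathfrak{p}'(z);z)\prec h(z)$, a function $q$ is a dominant if $\mathfrak{p}\prec q$ for all admissible analytic $\mathfrak{p}$ satisfying it; a univalent dominant $\tilde q$ with $\tilde q\prec q$ for all dominants $q$ is the best dominant. Here, with $\mathfrak{p}(z)=[f(z)/z^p]^a$, the differential subordination is $1+\frac{e^{i\lambda}}{pab\cos\lambda}\frac{z\mathfrak{p}'(z)}{\mathfrak{p}(z)}\prec\frac{1+(1-2\alpha)z}{1-z}$, the admissible functions being the analytic nonvanishing $\mathfrak{p}$ on $\mathbb{U}$ with $\mathfrak{p}(0)=1$.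 *)

theory Defs
  imports "HOL-Complex_Analysis.Complex_Analysis"
begin

abbreviation unit_disc :: "complex set"  where
  "unit_disc \<equiv> ball 0 1"

definition class_A :: "nat \<Rightarrow> (complex \<Rightarrow> complex) set" where
  "class_A p = {f. f holomorphic_on unit_disc \<and>
     (\<exists>a :: nat \<Rightarrow> complex. \<forall>z\<in>unit_disc.
        (\<lambda>k. a k * z ^ (p + 1 + k)) sums (f z - z ^ p))}"

definition subordinate :: "(complex \<Rightarrow> complex) \<Rightarrow> (complex \<Rightarrow> complex) \<Rightarrow> bool"
  (infix "\<prec>\<prec>" 50) where
  "g \<prec>\<prec> h \<longleftrightarrow> g holomorphic_on unit_disc \<and> h holomorphic_on unit_disc \<and>
     (\<exists>w. w holomorphic_on unit_disc \<and> w ` unit_disc \<subseteq> unit_disc \<and> w 0 = 0 \<and>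
          (\<forall>z\<in>unit_disc. g z = h (w z)))"

definition set_B :: "complex set" where
  "set_B = {z. cmod (z + 1) \<le> 1 \<or> cmod (z - 1) \<le> 1}"

(* f(z)/z^p and z f'(z)/(p f(z)) have removable singularities at 0 for f in class_A p, with
   value 1 there; in HOL the bare quotients would be 0 at 0. *)

definition normalized :: "nat \<Rightarrow> (complex \<Rightarrow> complex) \<Rightarrow> complex \<Rightarrow> complex" where
  "normalized p f z = (if z = 0 then 1 else f z / z ^ p)"

definition log_deriv_quot :: "nat \<Rightarrow> (complex \<Rightarrow> complex) \<Rightarrow> complex \<Rightarrow> complex" where
  "log_deriv_quot p f z = (if z = 0 then 1 else z * deriv f z / (of_nat p * f z))"

(* The logarithm of g on the disc that vanishes at 0, and the resulting branch of g^a with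
   value 1 at 0. It exists and is unique for nonvanishing holomorphic g with g 0 = 1; see
   disc_log and disc_log_unique below. It need not be the pointwise principal value Ln (g z),
   since g may take values on the negative real axis. *)

definition disc_log :: "(complex \<Rightarrow> complex) \<Rightarrow> complex \<Rightarrow> complex" where
  "disc_log g = (SOME l. l holomorphic_on unit_disc \<and> l 0 = 0 \<and>
                         (\<forall>z\<in>unit_disc. exp (l z) = g z))"

definition disc_power :: "(complex \<Rightarrow> complex) \<Rightarrow> complex \<Rightarrow> complex \<Rightarrow> complex" where
  "disc_power g a z = exp (a * disc_log g z)"

(* No nonvanishing condition on f is stated: class_S_nonzero below shows that the
   inequality excludes zeros of f other than 0, in spite of x / 0 = 0. *)

definition class_S :: "nat \<Rightarrow> real \<Rightarrow> real \<Rightarrow> complex \<Rightarrow> (complex \<Rightarrow> complex) set" where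
  "class_S p lam \<alpha> b = {f \<in> class_A p. \<forall>z\<in>unit_disc.
     Re (1 / (b * of_real (cos lam)) *
         (exp (\<i> * of_real lam) * log_deriv_quot p f z
          - (1 - b) * of_real (cos lam) - \<i> * of_real (sin lam))) > \<alpha>}"

(* Differential subordination psi(u(z), z u'(z); z) << h, restricted to u in the set Adm of
   admissible functions. *)

definition diff_subordination ::
  "(complex \<Rightarrow> complex \<Rightarrow> complex \<Rightarrow> complex) \<Rightarrow> (complex \<Rightarrow> complex) \<Rightarrow>
   (complex \<Rightarrow> complex) \<Rightarrow> bool" where
  "diff_subordination \<psi> h u \<longleftrightarrow> (\<lambda>z. \<psi> (u z) (z * deriv u z) z) \<prec>\<prec> h"

definition dominant ::
  "(complex \<Rightarrow> complex) set \<Rightarrow> (complex \<Rightarrow> complex \<Rightarrow> complex \<Rightarrow> complex) \<Rightarrow>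
   (complex \<Rightarrow> complex) \<Rightarrow> (complex \<Rightarrow> complex) \<Rightarrow> bool" where
  "dominant Adm \<psi> h q \<longleftrightarrow> q holomorphic_on unit_disc \<and>
     (\<forall>u\<in>Adm. diff_subordination \<psi> h u \<longrightarrow> u \<prec>\<prec> q)"

definition best_dominant ::
  "(complex \<Rightarrow> complex) set \<Rightarrow> (complex \<Rightarrow> complex \<Rightarrow> complex \<Rightarrow> complex) \<Rightarrow>
   (complex \<Rightarrow> complex) \<Rightarrow> (complex \<Rightarrow> complex) \<Rightarrow> bool" where
  "best_dominant Adm \<psi> h q \<longleftrightarrow> dominant Adm \<psi> h q \<and> inj_on q unit_disc \<and>
     (\<forall>r. dominant Adm \<psi> h r \<longrightarrow> q \<prec>\<prec> r)"

definition nonvanishing_normalized :: "(complex \<Rightarrow> complex) set" where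
  "nonvanishing_normalized =
     {u. u holomorphic_on unit_disc \<and> (\<forall>z\<in>unit_disc. u z \<noteq> 0) \<and> u 0 = 1}"

lemma disc_log:
  assumes "g \<in> nonvanishing_normalized"
  shows "disc_log g holomorphic_on unit_disc" "disc_log g 0 = 0"
    "\<And>z. z \<in> unit_disc \<Longrightarrow> exp (disc_log g z) = g z"
proof -
  have g: "g holomorphic_on unit_disc" "\<And>z. z \<in> unit_disc \<Longrightarrow> g z \<noteq> 0" "g 0 = 1"
    using assms by (auto simp: nonvanishing_normalized_def)
  obtain l where l: "l holomorphic_on unit_disc" "\<And>z. z \<in> unit_disc \<Longrightarrow> exp (l z) = g z"
    using holomorphic_logarithm_exists[of unit_disc g 0] g by auto
  have "exp (l 0) = 1" using l(2)[of 0] g(3) by simp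
  then have "(\<lambda>z. l z - l 0) holomorphic_on unit_disc \<and> l 0 - l 0 = 0 \<and>
      (\<forall>z\<in>unit_disc. exp (l z - l 0) = g z)"
    using l by (auto simp: exp_diff intro!: holomorphic_intros)
  from someI[of "\<lambda>l. l holomorphic_on unit_disc \<and> l 0 = 0 \<and> (\<forall>z\<in>unit_disc. exp (l z) = g z)", OF this]
  show "disc_log g holomorphic_on unit_disc" "disc_log g 0 = 0"
    "\<And>z. z \<in> unit_disc \<Longrightarrow> exp (disc_log g z) = g z"
    unfolding disc_log_def by auto
qed

lemma disc_log_unique:
  assumes l: "l holomorphic_on unit_disc" "l 0 = 0" "\<And>z. z \<in> unit_disc \<Longrightarrow> exp (l z) = g z"
    and z: "z \<in> unit_disc"
  shows "disc_log g z = l z"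
proof -
  have nv: "exp (l x) \<noteq> 0" for x by simp
  have "(\<lambda>z. exp (l z)) holomorphic_on unit_disc"
    using l(1) by (intro holomorphic_intros)
  then have "g holomorphic_on unit_disc"
    by (rule holomorphic_transform) (rule l(3))
  moreover have "g x \<noteq> 0" if "x \<in> unit_disc" for x
    using l(3)[OF that] nv[of x] by metis
  moreover have "g 0 = 1" using l(3)[of 0] l(2) by simp
  ultimately have "g \<in> nonvanishing_normalized"
    unfolding nonvanishing_normalized_def by blast
  note L = disc_log[OF this]
  define d where "d = (\<lambda>z. disc_log g z - l z)"
  have d: "continuous_on unit_disc d" unfolding d_def
    by (intro continuous_intros holomorphic_on_imp_continuous_on L l)
  have e: "exp (d x) = 1" if "x \<in> unit_disc" for x
    using L(3)[OF that] l(3)[OF that] nv[of x] by (simp add: d_def exp_diff)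
  have "d constant_on unit_disc"
  proof (rule continuous_discrete_range_constant[OF _ d])
    fix x assume x: "x \<in> unit_disc"
    show "\<exists>e>0. \<forall>y. y \<in> unit_disc \<and> d y \<noteq> d x \<longrightarrow> e \<le> cmod (d y - d x)"
    proof (intro exI[of _ "2 * pi"] conjI allI impI)
      fix y assume y: "y \<in> unit_disc \<and> d y \<noteq> d x"
      have "exp (d y) = exp (d x)" using e x y by simp
      then obtain n :: int where n: "d y = d x + of_int (2 * n) * of_real pi * \<i>"
        by (auto simp: exp_eq)
      with y have "n \<noteq> 0" by auto
      then have "1 \<le> \<bar>real_of_int n\<bar>" by linarith
      moreover have "cmod (d y - d x) = 2 * pi * \<bar>real_of_int n\<bar>"
        using n by (simp add: norm_mult)
      ultimately show "2 * pi \<le> cmod (d y - d x)" by simp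
    qed auto
  qed auto
  then have "d z = d 0" using z unfolding constant_on_def by auto
  then show ?thesis using L(2) l(2) by (simp add: d_def)
qed

lemma normalized_holomorphic:
  assumes "f \<in> class_A p"
  shows "normalized p f holomorphic_on unit_disc"
proof -
  obtain a where a: "\<And>z. z \<in> unit_disc \<Longrightarrow> (\<lambda>k. a k * z ^ (p + 1 + k)) sums (f z - z ^ p)"
    using assms unfolding class_A_def by blast
  define e where "e = case_nat (1 :: complex) a"
  have "(\<lambda>n. e n * (z - 0) ^ n) sums normalized p f z" if z: "z \<in> unit_disc" for z
  proof (cases "z = 0")
    case True
    have "(\<lambda>n. e n * 0 ^ n) sums e 0" by (rule powser_sums_zero)
    then show ?thesis using True by (simp add: normalized_def e_def)
  next
    case False
    have "(\<lambda>k. a k * z ^ (p + 1 + k) / z ^ p) sums ((f z - z ^ p) / z ^ p)"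
      by (intro sums_divide a z)
    moreover have "a k * z ^ (p + 1 + k) / z ^ p = e (Suc k) * z ^ Suc k" for k
      using False by (simp add: power_add e_def)
    moreover have "(f z - z ^ p) / z ^ p = normalized p f z - 1"
      using False by (simp add: normalized_def diff_divide_distrib)
    ultimately have "(\<lambda>k. e (Suc k) * z ^ Suc k) sums (normalized p f z - 1)" by simp
    then have "(\<lambda>k. e k * z ^ k) sums (normalized p f z - 1 + e 0 * z ^ 0)"
      by (subst (asm) sums_Suc_iff) (simp add: e_def)
    then show ?thesis by (simp add: e_def)
  qed
  then show ?thesis by (rule power_series_holomorphic)
qed

lemma class_S_nonzero:
  assumes f: "f \<in> class_S p lam \<alpha> b" and p: "p \<ge> 1" and b: "b \<noteq> 0" and lam: "cos lam \<noteq> 0"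
    and z0: "z0 \<in> unit_disc" "z0 \<noteq> 0"
  shows "f z0 \<noteq> 0"
proof
  assume f0: "f z0 = 0"
  have fA: "f \<in> class_A p" using f by (simp add: class_S_def)
  then have holf: "f holomorphic_on unit_disc" by (simp add: class_A_def)
  have "isCont (normalized p f) 0"
    using normalized_holomorphic[OF fA]
    by (metis centre_in_ball continuous_on_eq_continuous_at holomorphic_on_imp_continuous_on
        open_ball zero_less_one)
  then have "(normalized p f \<longlongrightarrow> 1) (at 0)"
    by (simp add: isCont_def normalized_def)
  then have "\<forall>\<^sub>F z in at 0. normalized p f z \<noteq> 0"
    by (rule tendsto_imp_eventually_ne) simp
  moreover have "\<forall>\<^sub>F z in at (0::complex). z \<in> unit_disc"
    by (rule eventually_at_in_open') auto
  ultimately have "\<forall>\<^sub>F z in at 0. normalized p f z \<noteq> 0 \<and> z \<in> unit_disc \<and> z \<noteq> 0"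
    by (intro eventually_conj) (auto simp: eventually_at_filter)
  then obtain \<beta> where "normalized p f \<beta> \<noteq> 0 \<and> \<beta> \<in> unit_disc \<and> \<beta> \<noteq> 0"
    using eventually_happens by force
  then have \<beta>: "\<beta> \<in> unit_disc" "f \<beta> \<noteq> 0" by (auto simp: normalized_def)
  have "\<not> f constant_on unit_disc"
    using f0 \<beta> z0 unfolding constant_on_def by metis
  from holomorphic_factor_zero_nonconstant[OF holf _ _ z0(1) f0 this]
  obtain g r n where n: "0 < n" and r: "0 < r" "ball z0 r \<subseteq> unit_disc"
    and g: "g holomorphic_on ball z0 r" "\<And>w. w \<in> ball z0 r \<Longrightarrow> f w = (w - z0) ^ n * g w"
      "\<And>w. w \<in> ball z0 r \<Longrightarrow> g w \<noteq> 0"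
    by (metis connected_ball open_ball)
  define A where "A = exp (\<i> * of_real lam) / (b * of_real (cos lam))"
  define G where "G = (\<lambda>w. 1 + A * (log_deriv_quot p f w - 1))"
  define B where "B = A * z0 * of_nat n / of_nat p"
  have B: "B \<noteq> 0" using p n b lam z0 by (simp add: B_def A_def)
  have ReG: "Re (G w) > \<alpha>" if "w \<in> unit_disc" for w
  proof -
    have "exp (\<i> * of_real lam) = of_real (cos lam) + \<i> * of_real (sin lam)"
      by (simp add: exp_Euler cos_of_real sin_of_real)
    then have "1 / (b * of_real (cos lam)) *
         (exp (\<i> * of_real lam) * log_deriv_quot p f w
          - (1 - b) * of_real (cos lam) - \<i> * of_real (sin lam)) = G w"
      using b lam unfolding G_def A_def by (simp add: field_simps)
    then show ?thesis using f that unfolding class_S_def by force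
  qed
  define H where "H = (\<lambda>w. (w - z0) * (1 - A) +
      A * w * (of_nat n + (w - z0) * deriv g w / g w) / of_nat p)"
  have G_eq: "(w - z0) * G w = H w" if w: "w \<in> ball z0 r" "w \<noteq> z0" "w \<noteq> 0" for w
  proof -
    have dg: "(g has_field_derivative deriv g w) (at w)"
      using g(1) w by (auto intro: holomorphic_derivI)
    have "((\<lambda>w. (w - z0) ^ n * g w) has_field_derivative
        (of_nat n * (w - z0) ^ (n - 1) * g w + (w - z0) ^ n * deriv g w)) (at w)"
      by (auto intro!: derivative_eq_intros dg)
    then have "(f has_field_derivative
        (of_nat n * (w - z0) ^ (n - 1) * g w + (w - z0) ^ n * deriv g w)) (at w)"
      by (rule has_field_derivative_transform_within_open[of _ _ _ "ball z0 r"])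
         (use w g(2) in auto)
    then have df: "deriv f w = of_nat n * (w - z0) ^ (n - 1) * g w + (w - z0) ^ n * deriv g w"
      by (rule DERIV_imp_deriv)
    obtain m where m: "n = Suc m" using n by (cases n) auto
    have alg: "u * ((k * u ^ m * y + u ^ Suc m * y') / (u ^ Suc m * y)) = k + u * y' / y"
      if "u \<noteq> 0" "y \<noteq> 0" for u k y y' :: complex
      using that by (simp add: field_simps)
    have "(w - z0) * (deriv f w / f w) = of_nat n + (w - z0) * deriv g w / g w"
      using alg[of "w - z0" "g w" "of_nat n" "deriv g w"] w g(3)[OF w(1)]
      unfolding df g(2)[OF w(1)] m by simp
    moreover have "(w - z0) * G w =
        (w - z0) * (1 - A) + A * w * ((w - z0) * (deriv f w / f w)) / of_nat p"
      using w by (simp add: G_def log_deriv_quot_def algebra_simps)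
    ultimately show ?thesis by (simp add: H_def)
  qed
  have "isCont H z0"
  proof -
    have "isCont g z0" "isCont (deriv g) z0"
      using g(1) r holomorphic_deriv[OF g(1)]
      by (metis centre_in_ball continuous_on_eq_continuous_at holomorphic_on_imp_continuous_on
          open_ball)+
    then show ?thesis unfolding H_def
      using g(3)[of z0] r p by (intro continuous_intros) auto
  qed
  then have H: "(H \<longlongrightarrow> B) (at z0)" by (simp add: isCont_def H_def B_def)
  define W where "W = (\<lambda>t :: real. z0 - of_real t * B)"
  have W: "filterlim W (at z0) (at_right 0)"
    unfolding filterlim_at
  proof
    have "(W \<longlongrightarrow> z0 - of_real 0 * B) (at_right 0)"
      unfolding W_def by (intro tendsto_intros)
    then show "(W \<longlongrightarrow> z0) (at_right 0)" by simp
    show "\<forall>\<^sub>F t in at_right 0. W t \<in> UNIV \<and> W t \<noteq> z0"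
      using B by (auto simp: W_def eventually_at_filter)
  qed
  have "((\<lambda>t. H (W t)) \<longlongrightarrow> B) (at_right 0)"
    using H W by (rule filterlim_compose)
  then have lim: "((\<lambda>t. Re (- (H (W t) / B))) \<longlongrightarrow> Re (- (B / B))) (at_right 0)"
    by (rule tendsto_Re[OF tendsto_minus[OF tendsto_divide[OF _ tendsto_const B]]])
  have "\<forall>\<^sub>F w in at z0. w \<in> ball z0 r - {0}"
    by (rule eventually_at_in_open') (use r z0 in auto)
  then have "\<forall>\<^sub>F w in at z0. w \<in> ball z0 r - {0} \<and> w \<noteq> z0"
    by (auto simp: eventually_at_filter elim: eventually_mono)
  from eventually_compose_filterlim[OF this W] eventually_at_right_less[of 0]
  have "\<forall>\<^sub>F t in at_right 0. t * \<alpha> \<le> Re (- (H (W t) / B))"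
  proof eventually_elim
    case (elim t)
    then have "H (W t) = - (of_real t * B * G (W t))"
      using G_eq[of "W t"] by (auto simp: W_def)
    then have "- (H (W t) / B) = of_real t * G (W t)" using B by simp
    then have "Re (- (H (W t) / B)) = t * Re (G (W t))" by simp
    moreover have "W t \<in> unit_disc" using elim r by blast
    ultimately show ?case using ReG[of "W t"] elim by simp
  qed
  moreover have "((\<lambda>t. t * \<alpha>) \<longlongrightarrow> 0 * \<alpha>) (at_right 0)" by (intro tendsto_intros)
  ultimately have "0 * \<alpha> \<le> Re (- (B / B))"
    using lim by (intro tendsto_le[OF _ lim]) auto
  then show False using B by simp
qed

end

theory Submission
  imports Defs
begin

text \<open>
  With \<open>u = (f(z)/z^p)^a = exp (c l)\<close> the hypothesis becomes \<open>Re (z l'(z)) > -1/2\<close>. If the function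
  \<open>w = 1 - exp (-l)\<close> left the unit disc, then at a first point \<open>z0\<close> with \<open>|w(z0)| = 1\<close> Jack's lemma
  would give \<open>z0 l'(z0) = k w(z0) / (1 - w(z0))\<close> with \<open>k \<ge> 1\<close>, of real part \<open>-k/2\<close>. Hence \<open>w\<close> is a
  Schwarz function, and \<open>u = (1 - w)^(-c)\<close>. The set \<open>B\<close> enters through the
  univalence of \<open>q = (1 - z)^(-c)\<close>: \<open>c \<in> B\<close> means \<open>|Re (1/c)| \<ge> 1/2\<close>, while two values of \<open>Ln (1 - z)\<close>
  on which \<open>exp (-c \<zeta>)\<close> agrees differ by \<open>2 \<pi> i n / c\<close>, and their imaginary parts differ by less than \<open>\<pi>\<close>.
  Finally \<open>q\<close> satisfies the differential subordination itself, so every dominant dominates it.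
\<close>

section \<open>Jack's lemma\<close>

text \<open>Rescaling to \<open>g z = w (z0 * z) / w z0\<close> gives a self-map of the unit disc
  fixing 0, with \<open>g 1 = 1\<close>. Schwarz's lemma bounds it by \<open>norm z\<close>, which
  forces its derivative \<open>D\<close> at 1 to be real and at least 1; this \<open>D\<close> is
  \<open>k\<close>.\<close>

lemma Jack:
  fixes w :: "complex \<Rightarrow> complex"
  assumes w: "w holomorphic_on ball 0 R" "w 0 = 0"
    and z0: "z0 \<in> ball 0 R" "w z0 \<noteq> 0"
    and less: "\<And>z. norm z < norm z0 \<Longrightarrow> norm (w z) < norm (w z0)"
  obtains k :: real where "k \<ge> 1" "z0 * deriv w z0 = of_real k * w z0"
proof -
  define g where "g = (\<lambda>z. w (z0 * z) / w z0)"
  define D where "D = z0 * deriv w z0 / w z0"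
  have "z0 \<noteq> 0" using z0 w by auto
  have maps: "z0 * z \<in> ball 0 R" if "norm z \<le> 1" for z
  proof -
    have "norm z0 * norm z \<le> norm z0" using that by (simp add: mult_left_le)
    then show ?thesis using z0(1) by (simp add: norm_mult)
  qed
  have "w \<circ> (\<lambda>z. z0 * z) holomorphic_on cball 0 1"
    by (rule holomorphic_on_compose_gen[OF _ w(1)]) (use maps in \<open>auto intro!: holomorphic_intros\<close>)
  then have holg: "g holomorphic_on cball 0 1"
    unfolding g_def using z0(2) by (intro holomorphic_intros) (auto simp: o_def)
  have glt: "norm (g z) < 1" if "norm z < 1" for z
    using less[of "z0 * z"] that \<open>z0 \<noteq> 0\<close> z0(2) by (simp add: g_def norm_mult norm_divide)
  have "norm (g z) \<le> norm z" if "norm z < 1" for z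
    by (rule Schwarz_Lemma(1)[OF holomorphic_on_subset[OF holg ball_subset_cball] _ glt that])
      (simp add: g_def w(2))
  \<comment> \<open>Schwarz's lemma covers the open disc only. Continuity extends the bound to the
    circle, where it is needed for the points \<open>exp (\<i> * t)\<close>.\<close>
  then have gle: "norm (g z) \<le> norm z" if "norm z \<le> 1" for z
    using continuous_le_on_closure[of "ball 0 1" "\<lambda>z. norm (g z) - norm z" z 0] that
    by (simp add: continuous_on_diff continuous_on_norm
        holomorphic_on_imp_continuous_on[OF holg] continuous_on_norm_id)
  have g1: "g 1 = 1" using z0 by (simp add: g_def)
  have dg: "(g has_field_derivative D) (at 1)"
  proof -
    have "(w has_field_derivative deriv w z0) (at (z0 * 1))"
      using w(1) z0(1) by (auto intro: holomorphic_derivI)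
    moreover have "((\<lambda>z. z0 * z) has_field_derivative z0) (at 1)"
      by (auto intro!: derivative_eq_intros)
    ultimately have "((\<lambda>z. w (z0 * z)) has_field_derivative deriv w z0 * z0) (at 1)"
      by (rule DERIV_chain2)
    from DERIV_cdivide[OF this, of "w z0"]
    show ?thesis unfolding g_def D_def by (simp add: mult.commute)
  qed
  \<comment> \<open>\<open>Re (g z) \<le> norm z\<close> with equality at \<open>1\<close>: differentiate along the radius and along the circle.\<close>
  have "Re D \<ge> 1"
  proof (rule ccontr)
    assume "\<not> ?thesis"
    have "((\<lambda>t. g (of_real t)) has_vector_derivative D) (at 1)"
      using dg by (intro has_vector_derivative_real_field) simp
    \<comment> \<open>If \<open>Re D < 1\<close>, the function \<open>t - Re (g t)\<close> increases
      through its zero at 1, so it is negative just to the left of 1, against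
      \<open>gle\<close>.\<close>
    then have "((\<lambda>t. t - Re (g (of_real t))) has_real_derivative 1 - Re D) (at 1)"
      by (auto intro!: derivative_eq_intros has_field_derivative_Re)
    from DERIV_pos_inc_left[OF this] \<open>\<not> ?thesis\<close>
    obtain d where d: "d > 0" "\<And>h. 0 < h \<Longrightarrow> h < d \<Longrightarrow>
        (1 - h) - Re (g (of_real (1 - h))) < 1 - Re (g (of_real 1))" by force
    \<comment> \<open>The cap at 1 keeps \<open>1 - h\<close> nonnegative, so that its norm is
      \<open>1 - h\<close> itself.\<close>
    define h where "h = min (d / 2) 1"
    have h: "0 < h" "h < d" "h \<le> 1" using d(1) by (auto simp: h_def)
    have "Re (g (of_real (1 - h))) \<le> 1 - h"
      using gle[of "of_real (1 - h)"] complex_Re_le_cmod[of "g (of_real (1 - h))"] h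
      by (simp only: norm_of_real) linarith
    then show False using d(2)[OF h(1,2)] g1 by simp
  qed
  moreover have "Im D = 0"
  proof -
    have "((\<lambda>z. exp (\<i> * z)) has_field_derivative \<i>) (at 0)"
      by (auto intro!: derivative_eq_intros)
    then have "((\<lambda>z. g (exp (\<i> * z))) has_field_derivative D * \<i>) (at 0)"
      using dg by (intro DERIV_chain2[of g]) auto
    then have "((\<lambda>t. g (exp (\<i> * of_real t))) has_vector_derivative \<i> * D) (at 0)"
      by (intro has_vector_derivative_real_field) (simp add: mult.commute)
    then have "((\<lambda>t. Re (g (exp (\<i> * of_real t)))) has_real_derivative Re (\<i> * D)) (at 0)"
      by (rule has_field_derivative_Re)
    moreover have "Re (g (exp (\<i> * of_real t))) \<le> Re (g (exp (\<i> * of_real 0)))" for t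
      using gle[of "exp (\<i> * of_real t)"] complex_Re_le_cmod[of "g (exp (\<i> * of_real t))"] g1
      by simp
    ultimately have "Re (\<i> * D) = 0"
      by (intro DERIV_local_max[of _ _ 0 1]) auto
    then show ?thesis by simp
  qed
  ultimately show thesis
    using z0(2) by (intro that[of "Re D"]) (auto simp: D_def complex_is_Real_iff of_real_Re)
qed

section \<open>From a bound on the logarithmic derivative to a Schwarz function\<close>

text \<open>This form shows at once that z / (1 - z) sends the unit circle without 1 to the line Re
  = -1/2, and the open disc to the right of that line. Both facts are used below.\<close>

lemma Re_divide_one_minus:
  fixes z :: complex
  assumes "z \<noteq> 1"
  shows "Re (z / (1 - z)) = (1 - (norm z)\<^sup>2) / (2 * (norm (1 - z))\<^sup>2) - 1 / 2"
proof -
  define N where "N = (norm (1 - z))\<^sup>2"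
  have "N \<noteq> 0" using assms by (simp add: N_def)
  have N: "N = (1 - Re z)\<^sup>2 + (Im z)\<^sup>2" by (simp add: N_def cmod_power2)
  have "Re (z / (1 - z)) = (Re z * (1 - Re z) - (Im z)\<^sup>2) / N"
    by (simp add: Re_divide N power2_eq_square)
  also have "Re z * (1 - Re z) - (Im z)\<^sup>2 = ((1 - (norm z)\<^sup>2) - N) / 2"
    unfolding N cmod_power2 by (simp add: power2_eq_square field_simps)
  also have "\<dots> / N = (1 - (norm z)\<^sup>2) / (2 * N) - 1 / 2"
    using \<open>N \<noteq> 0\<close> by (simp add: field_simps)
  finally show ?thesis by (simp add: N_def)
qed

lemma norm_one_minus_exp_less_one:
  assumes l: "l holomorphic_on unit_disc" "l 0 = 0"
    and re: "\<And>z. z \<in> unit_disc \<Longrightarrow> Re (z * deriv l z) > - 1 / 2"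
    and z: "z \<in> unit_disc"
  shows "norm (1 - exp (- l z)) < 1"
proof (rule ccontr)
  define w where "w = (\<lambda>z. 1 - exp (- l z))"
  assume "\<not> ?thesis"
  then have z1: "norm (w z) \<ge> 1" by (simp add: w_def)
  have w: "w holomorphic_on unit_disc" "w 0 = 0"
    unfolding w_def using l by (auto intro!: holomorphic_intros)
  have sub: "cball 0 (norm z) \<subseteq> unit_disc" using z by auto
  \<comment> \<open>A point of least modulus in the compact set \<open>S\<close> serves as the first
    exit point: \<open>norm (w x) < 1\<close> on the open disc of radius
    \<open>norm z0\<close>.\<close>
  define S where "S = cball 0 (norm z) \<inter> (\<lambda>x. norm (w x)) -` {1..}"
  have cont: "continuous_on (cball 0 (norm z)) (\<lambda>x. norm (w x))"
    by (intro continuous_on_norm continuous_on_subset[OF holomorphic_on_imp_continuous_on[OF w(1)] sub])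
  then have "closed S" unfolding S_def by (intro continuous_closed_preimage) auto
  then have "compact S"
    using bounded_subset[OF bounded_cball, of S 0 "norm z"] by (auto simp: S_def compact_eq_bounded_closed)
  moreover have "z \<in> S" using z1 by (simp add: S_def)
  ultimately obtain z0 where z0: "z0 \<in> S" "\<And>x. x \<in> S \<Longrightarrow> norm z0 \<le> norm x"
    using continuous_attains_inf[of S norm] by (auto intro: continuous_intros)
  have less1: "norm (w x) < 1" if "norm x < norm z0" for x
    using z0(2)[of x] z0(1) that by (force simp: S_def)
  have "z0 \<noteq> 0" using z0(1) w(2) by (auto simp: S_def)
  have "norm (w z0) \<le> 1"
  proof (rule continuous_le_on_closure[of "ball 0 (norm z0)" "\<lambda>x. norm (w x)"])
    show "continuous_on (closure (ball 0 (norm z0))) (\<lambda>x. norm (w x))"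
      using \<open>z0 \<noteq> 0\<close> z0(1) by (auto simp: S_def intro: continuous_on_subset[OF cont])
  qed (use \<open>z0 \<noteq> 0\<close> less1 in \<open>auto simp: less_imp_le\<close>)
  then have n1: "norm (w z0) = 1" using z0(1) by (auto simp: S_def)
  have z0': "z0 \<in> unit_disc" using z0(1) sub by (auto simp: S_def)
  \<comment> \<open>\<open>k * w z0 / (1 - w z0)\<close> with \<open>norm (w z0) = 1\<close> has real part \<open>- k / 2\<close>, against \<open>re\<close>.\<close>
  obtain k where k: "k \<ge> 1" "z0 * deriv w z0 = of_real k * w z0"
    using Jack[OF w z0'] n1 less1 by (metis norm_zero zero_neq_one)
  \<comment> \<open>Since \<open>exp (- l) = 1 - w\<close>, this reads
    \<open>deriv w = (1 - w) * deriv l\<close>, which turns Jack's identity for \<open>w\<close>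
    into one for \<open>l\<close>.\<close>
  have "(w has_field_derivative exp (- l z0) * deriv l z0) (at z0)"
    unfolding w_def using holomorphic_derivI[OF l(1) open_ball z0']
    by (auto intro!: derivative_eq_intros)
  then have "(1 - w z0) * (z0 * deriv l z0) = of_real k * w z0"
    using k(2) by (simp add: DERIV_imp_deriv w_def mult_ac)
  moreover have ne: "1 - w z0 \<noteq> 0" by (simp add: w_def)
  ultimately have "z0 * deriv l z0 = of_real k * (w z0 / (1 - w z0))"
    by (simp add: eq_divide_eq mult.commute)
  moreover have "Re (w z0 / (1 - w z0)) = - 1 / 2"
    using ne n1 by (simp add: Re_divide_one_minus del: Re_divide)
  moreover have "Re (of_real k * x) = k * Re x" for x by simp
  ultimately show False using re[OF z0'] k(1) by (simp only:)
qed

text \<open>With \<open>u = exp (c * l)\<close> the quotient in the hypothesis is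
  \<open>z * deriv l z\<close>, so the preceding lemma makes \<open>w = 1 - exp (- l)\<close> the
  Schwarz function. Stated for every admissible \<open>u\<close>, it serves both the powers of
  f(z)/z^p and the dominance of \<open>q\<close>.\<close>

lemma subordinate_powr:
  assumes u: "u \<in> nonvanishing_normalized" and c: "c \<noteq> 0"
    and re: "\<And>z. z \<in> unit_disc \<Longrightarrow> Re (z * deriv u z / (c * u z)) > - 1 / 2"
  shows "u \<prec>\<prec> (\<lambda>z. (1 - z) powr (- c))"
proof -
  note L = disc_log[OF u]
  define l where "l = (\<lambda>z. disc_log u z / c)"
  have l: "l holomorphic_on unit_disc" "l 0 = 0"
    using L c by (auto simp: l_def intro!: holomorphic_intros)
  have ul: "exp (c * l z) = u z" if "z \<in> unit_disc" for z
    using L(3)[OF that] c by (simp add: l_def)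
  have du: "deriv u z = c * u z * deriv l z" if "z \<in> unit_disc" for z
  proof -
    have "((\<lambda>z. exp (c * l z)) has_field_derivative c * u z * deriv l z) (at z)"
      using holomorphic_derivI[OF l(1) open_ball that] ul[OF that]
      by (auto intro!: derivative_eq_intros)
    then have "(u has_field_derivative c * u z * deriv l z) (at z)"
      by (rule has_field_derivative_transform_within_open[of _ _ _ unit_disc])
         (use that ul in auto)
    then show ?thesis by (rule DERIV_imp_deriv)
  qed
  define w where "w = (\<lambda>z. 1 - exp (- l z))"
  have w: "w holomorphic_on unit_disc" "w 0 = 0"
    using l by (auto simp: w_def intro!: holomorphic_intros)
  have unz: "u z \<noteq> 0" if "z \<in> unit_disc" for z using u that by (auto simp: nonvanishing_normalized_def)
  have w1: "norm (w z) < 1" if "z \<in> unit_disc" for z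
    unfolding w_def
  proof (rule norm_one_minus_exp_less_one[OF l _ that])
    fix x assume x: "x \<in> unit_disc"
    then show "Re (x * deriv l x) > - 1 / 2" using re[OF x] unz[OF x] c by (simp add: du)
  qed
  have slit: "1 - x \<notin> \<real>\<^sub>\<le>\<^sub>0" if "norm x < 1" for x :: complex
    using complex_Re_le_cmod[of x] that by (auto simp: complex_nonpos_Reals_iff)
  \<comment> \<open>A priori the two sides agree only modulo 2 pi i. Both are holomorphic logarithms
    of \<open>1 - w\<close> vanishing at 0, because \<open>1 - w\<close> stays in the right
    half-plane, so \<open>disc_log_unique\<close> identifies them.\<close>
  have ln: "Ln (1 - w z) = - l z" if z: "z \<in> unit_disc" for z
  proof -
    have "disc_log (\<lambda>z. 1 - w z) z = Ln (1 - w z)"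
    proof (rule disc_log_unique[OF _ _ _ z])
      show "(\<lambda>z. Ln (1 - w z)) holomorphic_on unit_disc"
        using w slit w1 by (intro holomorphic_intros) auto
      show "exp (Ln (1 - w x)) = 1 - w x" for x by (simp add: w_def)
    qed (simp add: w)
    moreover have "disc_log (\<lambda>z. 1 - w z) z = - l z"
      using l z by (intro disc_log_unique holomorphic_intros) (auto simp: w_def)
    ultimately show ?thesis by simp
  qed
  have "u z = (1 - w z) powr (- c)" if "z \<in> unit_disc" for z
    using ul[OF that] ln[OF that] by (simp add: powr_def w_def)
  moreover have "(\<lambda>z. (1 - z) powr (- c)) holomorphic_on unit_disc"
    using slit by (auto intro!: holomorphic_intros)
  moreover have "u holomorphic_on unit_disc" using u by (simp add: nonvanishing_normalized_def)
  ultimately show ?thesis unfolding subordinate_def using w w1 by auto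
qed

section \<open>Subordination to the half-plane map\<close>

text \<open>The right-hand function maps the disc conformally onto the half-plane Re > \<alpha> with
  0 going to 1, so the Schwarz function is its inverse composed with \<open>g\<close>.\<close>

lemma subordinate_half_plane_iff:
  fixes \<alpha> :: real
  assumes "\<alpha> < 1"
  shows "g \<prec>\<prec> (\<lambda>z. (1 + of_real (1 - 2 * \<alpha>) * z) / (1 - z)) \<longleftrightarrow>
    g holomorphic_on unit_disc \<and> g 0 = 1 \<and> (\<forall>z\<in>unit_disc. Re (g z) > \<alpha>)"
    (is "g \<prec>\<prec> ?h \<longleftrightarrow> ?R")
proof
  have h: "?h z = 1 + of_real (2 * (1 - \<alpha>)) * (z / (1 - z))" if "norm z < 1" for z :: complex
  proof -
    have "1 - z \<noteq> 0" using that by auto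
    then show ?thesis by (simp add: field_simps)
  qed
  have re: "Re (z / (1 - z)) > - 1 / 2" if "norm z < 1" for z :: complex
  proof -
    have "z \<noteq> 1" using that by auto
    moreover have "(norm z)\<^sup>2 < 1" using that by (simp add: power_less_one_iff)
    ultimately show ?thesis by (simp add: Re_divide_one_minus del: Re_divide)
  qed
  assume "g \<prec>\<prec> ?h"
  then obtain w where g: "g holomorphic_on unit_disc" and w: "w ` unit_disc \<subseteq> unit_disc" "w 0 = 0"
    "\<And>z. z \<in> unit_disc \<Longrightarrow> g z = ?h (w z)"
    unfolding subordinate_def by blast
  have "Re (g z) > \<alpha>" if "z \<in> unit_disc" for z
  proof -
    have "norm (w z) < 1" using w(1) that by (force simp: image_subset_iff)
    from re[OF this] h[OF this] w(3)[OF that]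
    have "Re (g z) = Re (1 + of_real (2 * (1 - \<alpha>)) * (w z / (1 - w z)))" by simp
    then have "Re (g z) = 1 + 2 * (1 - \<alpha>) * Re (w z / (1 - w z))"
      by (simp only: plus_complex.sel one_complex.sel times_complex.sel Re_complex_of_real Im_complex_of_real)
    moreover have "2 * (1 - \<alpha>) * Re (w z / (1 - w z)) > 2 * (1 - \<alpha>) * (- 1 / 2)"
      using assms by (intro mult_strict_left_mono re \<open>norm (w z) < 1\<close>) auto
    ultimately show ?thesis by (simp add: algebra_simps)
  qed
  then show ?R using g w(2) w(3)[of 0] by simp
next
  assume R: ?R
  define w where "w = (\<lambda>z. (g z - 1) / (g z + 1 - 2 * of_real \<alpha>))"
  have nz: "g z + 1 - 2 * of_real \<alpha> \<noteq> 0" if "z \<in> unit_disc" for z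
  proof -
    have "Re (g z) > \<alpha>" using R that by auto
    then show ?thesis using assms by (auto simp: complex_eq_iff)
  qed
  have w: "w holomorphic_on unit_disc" "w 0 = 0"
    using R nz by (auto simp: w_def intro!: holomorphic_intros)
  have "norm (w z) < 1" if z: "z \<in> unit_disc" for z
  proof -
    have "Re (g z) > \<alpha>" using R z by auto
    \<comment> \<open>Four times this product is the difference of the two squares below.
      Geometrically, \<open>g z\<close> is closer to 1 than to \<open>2 * \<alpha> - 1\<close>, the
      mirror image of 1 in the line Re = \<alpha>.\<close>
    then have "(Re (g z) - \<alpha>) * (1 - \<alpha>) > 0" using assms by simp
    then have "(Re (g z) - 1)\<^sup>2 < (Re (g z) + 1 - 2 * \<alpha>)\<^sup>2"
      by (simp add: power2_eq_square algebra_simps)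
    then have "norm (g z - 1) < norm (g z + 1 - 2 * of_real \<alpha>)"
      by (simp add: cmod_def)
    then show ?thesis using nz[OF z] by (simp add: w_def norm_divide)
  qed
  moreover have "g z = ?h (w z)" if "z \<in> unit_disc" for z
  proof -
    have "1 - w z = of_real (2 * (1 - \<alpha>)) / (g z + 1 - 2 * of_real \<alpha>)"
      using nz[OF that] by (simp add: w_def field_simps)
    moreover have "1 + of_real (1 - 2 * \<alpha>) * w z = g z * of_real (2 * (1 - \<alpha>)) / (g z + 1 - 2 * of_real \<alpha>)"
      using nz[OF that] by (simp add: w_def field_simps)
    moreover have "of_real (2 * (1 - \<alpha>)) \<noteq> (0 :: complex)" using assms by (simp del: of_real_mult of_real_diff)
    ultimately show ?thesis using nz[OF that] by simp
  qed
  moreover have "?h holomorphic_on unit_disc" by (intro holomorphic_intros) auto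
  ultimately show "g \<prec>\<prec> ?h"
    unfolding subordinate_def using R w by auto
qed

section \<open>Univalence of q\<close>

lemma inj_on_one_minus_powr:
  assumes "c \<in> set_B" "c \<noteq> 0"
  shows "inj_on (\<lambda>z. (1 - z) powr (- c)) unit_disc"
proof
  fix x y assume x: "x \<in> unit_disc" and y: "y \<in> unit_disc"
    and eq: "(1 - x) powr (- c) = (1 - y) powr (- c)"
  have nz: "1 - z \<noteq> 0" "\<bar>Im (Ln (1 - z))\<bar> < pi / 2" if "z \<in> unit_disc" for z
  proof -
    have pos: "Re (1 - z) > 0" using that complex_Re_le_cmod[of z] by auto
    then show "1 - z \<noteq> 0" by auto
    show "\<bar>Im (Ln (1 - z))\<bar> < pi / 2" using pos by (rule Re_Ln_pos_lt_imp)
  qed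
  from eq nz[OF x] nz[OF y] have "exp (- c * Ln (1 - x)) = exp (- c * Ln (1 - y))"
    by (simp add: powr_def)
  then obtain n :: int where "- c * Ln (1 - x) = - c * Ln (1 - y) + of_int (2 * n) * of_real pi * \<i>"
    by (auto simp: exp_eq)
  then have "Ln (1 - y) - Ln (1 - x) = of_real (2 * n * pi) * (\<i> * (1 / c))"
    using assms(2) by (simp add: field_simps)
  then have "Im (Ln (1 - y) - Ln (1 - x)) = Im (of_real (2 * n * pi) * (\<i> * (1 / c)))"
    by (rule arg_cong)
  then have im: "Im (Ln (1 - y)) - Im (Ln (1 - x)) = 2 * n * pi * Re (1 / c)"
    by (simp only: minus_complex.sel times_complex.sel Re_complex_of_real Im_complex_of_real) simp
  \<comment> \<open>Expanding the two discs of \<open>set_B\<close> gives |c|^2 <= 2 |Re c|, and Re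
    (1/c) = Re c / |c|^2.\<close>
  have "\<bar>Re (1 / c)\<bar> \<ge> 1 / 2"
  proof -
    have pos: "(Re c)\<^sup>2 + (Im c)\<^sup>2 > 0" using assms(2)
      by (simp add: complex_eq_iff sum_power2_gt_zero_iff)
    have "(Re c + 1)\<^sup>2 + (Im c)\<^sup>2 \<le> 1 \<or> (Re c - 1)\<^sup>2 + (Im c)\<^sup>2 \<le> 1"
      using assms(1) by (simp add: set_B_def cmod_def)
    then have "2 * \<bar>Re c\<bar> \<ge> (Re c)\<^sup>2 + (Im c)\<^sup>2"
      by (auto simp: power2_eq_square algebra_simps)
    then have "\<bar>Re c\<bar> / ((Re c)\<^sup>2 + (Im c)\<^sup>2) \<ge> 1 / 2" using pos by (simp add: field_simps)
    then show ?thesis using pos by (simp add: Re_divide)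
  qed
  have "n = 0"
  proof (rule ccontr)
    assume "n \<noteq> 0"
    then have "1 \<le> \<bar>real_of_int n\<bar>" by linarith
    then have "1 * (1 / 2) \<le> \<bar>real_of_int n\<bar> * \<bar>Re (1 / c)\<bar>"
      using \<open>\<bar>Re (1 / c)\<bar> \<ge> 1 / 2\<close> by (intro mult_mono) auto
    \<comment> \<open>A nonzero \<open>n\<close> would separate the two imaginary parts by at least
      pi, while each lies strictly between -pi/2 and pi/2.\<close>
    then have "pi * 1 \<le> pi * (2 * (\<bar>real_of_int n\<bar> * \<bar>Re (1 / c)\<bar>))"
      by (intro mult_left_mono) auto
    also have "\<dots> = \<bar>2 * n * pi * Re (1 / c)\<bar>" by (simp add: abs_mult del: Re_divide)
    also have "\<dots> < pi" using nz(2)[OF x] nz(2)[OF y] unfolding im[symmetric] by linarith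
    finally show False by simp
  qed
  have "1 - x = 1 - y"
  proof -
    have "Ln (1 - y) = Ln (1 - x)"
      using \<open>Ln (1 - y) - Ln (1 - x) = _\<close> \<open>n = 0\<close> by simp
    then show ?thesis using nz(1)[OF x] nz(1)[OF y] by (metis exp_Ln)
  qed
  then show "x = y" by simp
qed

section \<open>Logarithmic derivatives of q and of powers of f(z)/z^p\<close>

lemma one_minus_powr_nonvanishing_normalized:
  "(\<lambda>z. (1 - z) powr (- c)) \<in> nonvanishing_normalized"
proof -
  have "1 - z \<notin> \<real>\<^sub>\<le>\<^sub>0" if "norm z < 1" for z :: complex
    using complex_Re_le_cmod[of z] that by (auto simp: complex_nonpos_Reals_iff)
  then show ?thesis
    unfolding nonvanishing_normalized_def by (auto intro!: holomorphic_intros)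
qed

lemma deriv_one_minus_powr:
  assumes z: "z \<in> unit_disc"
  shows "deriv (\<lambda>z. (1 - z) powr (- c)) z = c * (1 - z) powr (- c) / (1 - z)"
proof -
  have "Re (1 - z) > 0" using z complex_Re_le_cmod[of z] by auto
  then have "1 - z \<notin> \<real>\<^sub>\<le>\<^sub>0" by (auto simp: complex_nonpos_Reals_iff)
  then have "1 - z \<noteq> 0" by auto
  have "((\<lambda>z. (1 - z) powr (- c)) has_field_derivative c * (1 - z) powr (- c) / (1 - z)) (at z)"
    using \<open>1 - z \<notin> \<real>\<^sub>\<le>\<^sub>0\<close> \<open>1 - z \<noteq> 0\<close>
    by (auto intro!: derivative_eq_intros simp: powr_diff powr_minus)
  then show ?thesis by (rule DERIV_imp_deriv)
qed

lemma disc_power_nonvanishing_normalized: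
  assumes "g \<in> nonvanishing_normalized"
  shows "disc_power g a \<in> nonvanishing_normalized"
  using disc_log[OF assms]
  by (auto simp: nonvanishing_normalized_def disc_power_def[abs_def] intro!: holomorphic_intros)

lemma deriv_disc_power:
  assumes g: "g \<in> nonvanishing_normalized" and z: "z \<in> unit_disc"
  shows "deriv (disc_power g a) z / disc_power g a z = a * (deriv g z / g z)"
proof -
  note L = disc_log[OF g]
  note dL = holomorphic_derivI[OF L(1) open_ball z]
  have "(disc_power g a has_field_derivative a * deriv (disc_log g) z * disc_power g a z) (at z)"
    unfolding disc_power_def[abs_def] by (auto intro!: derivative_eq_intros dL)
  moreover have "((\<lambda>z. exp (disc_log g z)) has_field_derivative deriv (disc_log g) z * g z) (at z)"
    using L(3)[OF z] by (auto intro!: derivative_eq_intros dL)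
  then have "(g has_field_derivative deriv (disc_log g) z * g z) (at z)"
    by (rule has_field_derivative_transform_within_open[of _ _ _ unit_disc]) (use z L in auto)
  moreover have "g z \<noteq> 0" using g z by (auto simp: nonvanishing_normalized_def)
  ultimately show ?thesis by (simp add: DERIV_imp_deriv disc_power_def)
qed

text \<open>Away from 0 this is (f/z^p)'/(f/z^p) = f'/f - p/z, multiplied by z. At 0 both sides
  vanish because \<open>log_deriv_quot\<close> is given the value 1 there.\<close>

lemma deriv_normalized:
  assumes f: "f \<in> class_A p" and p: "p \<ge> 1" and z: "z \<in> unit_disc" and nz: "z \<noteq> 0 \<Longrightarrow> f z \<noteq> 0"
  shows "z * (deriv (normalized p f) z / normalized p f z) = of_nat p * (log_deriv_quot p f z - 1)"
proof (cases "z = 0")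
  case False
  have "(f has_field_derivative deriv f z) (at z)"
    using f z by (auto simp: class_A_def intro: holomorphic_derivI)
  then have "((\<lambda>z. f z / z ^ p) has_field_derivative
      (deriv f z * z ^ p - f z * (of_nat p * z ^ (p - 1))) / (z ^ p * z ^ p)) (at z)"
    using False by (auto intro!: derivative_eq_intros)
  then have "(normalized p f has_field_derivative
      (deriv f z * z ^ p - f z * (of_nat p * z ^ (p - 1))) / (z ^ p * z ^ p)) (at z)"
    by (rule has_field_derivative_transform_within_open[of _ _ _ "- {0}"])
       (use False in \<open>auto simp: normalized_def\<close>)
  then have d: "deriv (normalized p f) z =
      (deriv f z * z ^ p - f z * (of_nat p * z ^ (p - 1))) / (z ^ p * z ^ p)"
    by (rule DERIV_imp_deriv)
  obtain m where "p = Suc m" using p by (cases p) auto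
  then show ?thesis using False nz p unfolding d
    by (simp add: normalized_def log_deriv_quot_def field_simps del: of_nat_Suc)
qed (simp add: log_deriv_quot_def)

section \<open>Subordination for the class S and the best dominant\<close>

theorem corollary3p1p3:
  fixes p :: nat and a b c :: complex and \<alpha> lam :: real
  assumes "p \<ge> 1" and "b \<noteq> 0" and "a \<noteq> 0"
    and "0 \<le> \<alpha>" and "\<alpha> < 1"
    and "- (pi / 2) < lam" and "lam < pi / 2"
    and c: "c = 2 * of_nat p * a * b * of_real (1 - \<alpha>) * exp (- (\<i> * of_real lam)) * of_real (cos lam)"
    and "c \<in> set_B"
  shows "(\<forall>f\<in>class_S p lam \<alpha> b.
            disc_power (normalized p f) a \<prec>\<prec> (\<lambda>z. 1 / (1 - z) powr c)) \<and>
         (\<forall>f\<in>class_A p. f \<in> class_S p lam \<alpha> b \<longleftrightarrow>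
            (\<lambda>z. 1 + exp (\<i> * of_real lam) / (b * of_real (cos lam)) * (log_deriv_quot p f z - 1))
              \<prec>\<prec> (\<lambda>z. (1 + of_real (1 - 2 * \<alpha>) * z) / (1 - z))) \<and>
         (\<forall>f\<in>class_A p.
            (\<lambda>z. 1 + exp (\<i> * of_real lam) / (b * of_real (cos lam)) * (log_deriv_quot p f z - 1))
              \<prec>\<prec> (\<lambda>z. (1 + of_real (1 - 2 * \<alpha>) * z) / (1 - z)) \<longrightarrow>
            disc_power (normalized p f) a \<prec>\<prec> (\<lambda>z. 1 / (1 - z) powr c)) \<and>
         best_dominant nonvanishing_normalized
           (\<lambda>r s z. 1 + exp (\<i> * of_real lam) / (of_nat p * a * b * of_real (cos lam)) * (s / r))
           (\<lambda>z. (1 + of_real (1 - 2 * \<alpha>) * z) / (1 - z))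
           (\<lambda>z. (1 - z) powr (- c))"
proof -
  define h where "h = (\<lambda>z :: complex. (1 + of_real (1 - 2 * \<alpha>) * z) / (1 - z))"
  define q where "q = (\<lambda>z. (1 - z) powr (- c))"
  define K where "K = exp (\<i> * of_real lam) / (of_nat p * a * b * of_real (cos lam))"
  define A where "A = exp (\<i> * of_real lam) / (b * of_real (cos lam))"
  define G where "G = (\<lambda>f z. 1 + A * (log_deriv_quot p f z - 1))"
  have cos: "cos lam \<noteq> 0" using cos_gt_zero_pi[of lam] assms by auto
  have "c \<noteq> 0" unfolding c using assms cos by auto
  \<comment> \<open>This identity explains the exponent \<open>c\<close>: it makes
    \<open>Re (1 + K * (z * deriv u z / u z)) > \<alpha>\<close> the same as
    \<open>Re (z * deriv u z / (c * u z)) > - 1 / 2\<close>.\<close>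
  have K: "K = 2 * of_real (1 - \<alpha>) / c"
    unfolding K_def c using assms cos by (simp add: exp_minus field_simps)
  have dom: "u \<prec>\<prec> q"
    if u: "u \<in> nonvanishing_normalized"
      and re: "\<And>z. z \<in> unit_disc \<Longrightarrow> Re (1 + K * (z * deriv u z / u z)) > \<alpha>" for u
    unfolding q_def
  proof (rule subordinate_powr[OF u \<open>c \<noteq> 0\<close>])
    fix z assume "z \<in> unit_disc"
    moreover have "1 + K * (z * deriv u z / u z)
        = 1 + of_real (2 * (1 - \<alpha>)) * (z * deriv u z / (c * u z))"
      by (simp add: K)
    ultimately have "Re (1 + of_real (2 * (1 - \<alpha>)) * (z * deriv u z / (c * u z))) > \<alpha>"
      using re[of z] by simp
    then have "1 + 2 * (1 - \<alpha>) * Re (z * deriv u z / (c * u z)) > \<alpha>"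
      by (simp only: plus_complex.sel one_complex.sel times_complex.sel Re_complex_of_real Im_complex_of_real)
    then have "(1 - \<alpha>) * (1 + 2 * Re (z * deriv u z / (c * u z))) > 0"
      by (simp add: algebra_simps del: Re_divide)
    then show "Re (z * deriv u z / (c * u z)) > - 1 / 2"
      using assms by (simp add: zero_less_mult_iff del: Re_divide)
  qed
  \<comment> \<open>By Euler's formula the trigonometric terms combine to
    \<open>- exp (\<i> * lam) + b * cos lam\<close>.\<close>
  have G_class_S: "1 / (b * of_real (cos lam)) *
         (exp (\<i> * of_real lam) * log_deriv_quot p f z
          - (1 - b) * of_real (cos lam) - \<i> * of_real (sin lam)) = G f z" for f z
  proof -
    have "exp (\<i> * of_real lam) = of_real (cos lam) + \<i> * of_real (sin lam)"
      by (simp add: exp_Euler cos_of_real sin_of_real)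
    then show ?thesis
      using assms cos unfolding G_def A_def by (simp add: field_simps)
  qed
  have class_S: "f \<in> class_S p lam \<alpha> b \<longleftrightarrow> f \<in> class_A p \<and> (\<forall>z\<in>unit_disc. Re (G f z) > \<alpha>)" for f
    unfolding class_S_def G_class_S by simp
  have nn: "normalized p f \<in> nonvanishing_normalized" if "f \<in> class_S p lam \<alpha> b" for f
    using that normalized_holomorphic[of f p] class_S_nonzero[OF that] assms cos
    by (auto simp: nonvanishing_normalized_def class_S normalized_def)
  have G_eq: "1 + A / of_nat p * (z * (deriv (normalized p f) z / normalized p f z)) = G f z"
    if "f \<in> class_S p lam \<alpha> b" "z \<in> unit_disc" for f z
    using deriv_normalized[of f p z] class_S_nonzero[OF that(1)] that assms cos
    by (simp add: class_S G_def)
  have part1: "disc_power (normalized p f) a \<prec>\<prec> q" if f: "f \<in> class_S p lam \<alpha> b" for f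
  proof (rule dom[OF disc_power_nonvanishing_normalized[OF nn[OF f]]])
    fix z assume z: "z \<in> unit_disc"
    have "K * (z * deriv (disc_power (normalized p f) a) z / disc_power (normalized p f) a z)
      = K * a * (z * (deriv (normalized p f) z / normalized p f z))"
      using deriv_disc_power[OF nn[OF f] z, of a] by (metis mult.assoc mult.left_commute times_divide_eq_right)
    \<comment> \<open>The factor \<open>a\<close> from the logarithmic derivative of the power
      cancels the one in the denominator of \<open>K\<close>, leaving \<open>G f\<close>.\<close>
    moreover have "K * a = A / of_nat p" using assms by (simp add: K_def A_def)
    ultimately have "1 + K * (z * deriv (disc_power (normalized p f) a) z / disc_power (normalized p f) a z) = G f z"
      using G_eq[OF f z] by simp
    then show "Re (1 + K * (z * deriv (disc_power (normalized p f) a) z / disc_power (normalized p f) a z)) > \<alpha>"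
      using f z by (simp add: class_S)
  qed
  have part2: "f \<in> class_S p lam \<alpha> b \<longleftrightarrow> G f \<prec>\<prec> h" if f: "f \<in> class_A p" for f
  proof -
    have "G f 0 = 1" by (simp add: G_def log_deriv_quot_def)
    \<comment> \<open>Subordination demands holomorphy also at 0, where
      \<open>log_deriv_quot\<close> is defined by cases; the logarithmic derivative of the
      nonvanishing \<open>normalized p f\<close> supplies it.\<close>
    moreover have "G f holomorphic_on unit_disc" if S: "f \<in> class_S p lam \<alpha> b"
    proof (rule holomorphic_transform[OF _ G_eq[OF S]])
      show "(\<lambda>z. 1 + A / of_nat p * (z * (deriv (normalized p f) z / normalized p f z))) holomorphic_on unit_disc"
        using nn[OF S] assms by (auto simp: nonvanishing_normalized_def intro!: holomorphic_intros)
    qed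
    ultimately show ?thesis
      unfolding h_def subordinate_half_plane_iff[OF \<open>\<alpha> < 1\<close>] using f by (auto simp: class_S)
  qed
  have dominant: "dominant nonvanishing_normalized (\<lambda>r s z. 1 + K * (s / r)) h q"
    unfolding dominant_def diff_subordination_def h_def subordinate_half_plane_iff[OF \<open>\<alpha> < 1\<close>]
    using dom one_minus_powr_nonvanishing_normalized[of c]
    by (simp add: nonvanishing_normalized_def q_def)
  have "q \<prec>\<prec> r" if "dominant nonvanishing_normalized (\<lambda>r s z. 1 + K * (s / r)) h r" for r
  proof -
    \<comment> \<open>For \<open>q\<close> the differential subordination is an equality, so the
      identity is its Schwarz function. As \<open>q\<close> is admissible, every dominant must
      dominate it.\<close>
    have q: "1 + K * (z * deriv q z / q z) = h z" if "z \<in> unit_disc" for z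
    proof -
      have "z \<noteq> 1" using that by auto
      then have "K * (z * deriv q z / q z) = 2 * of_real (1 - \<alpha>) * (z / (1 - z))"
        using that \<open>c \<noteq> 0\<close> by (simp add: q_def deriv_one_minus_powr K)
      then show ?thesis using \<open>z \<noteq> 1\<close> by (simp add: h_def field_simps)
    qed
    have "h holomorphic_on unit_disc" unfolding h_def by (intro holomorphic_intros) auto
    moreover from this have "(\<lambda>z. 1 + K * (z * deriv q z / q z)) holomorphic_on unit_disc"
      by (rule holomorphic_transform) (simp only: q)
    ultimately have "(\<lambda>z. 1 + K * (z * deriv q z / q z)) \<prec>\<prec> h"
      unfolding subordinate_def using q by (auto intro!: exI[of _ "\<lambda>z. z"])
    then show ?thesis
      using that one_minus_powr_nonvanishing_normalized[of c]
      by (simp add: dominant_def diff_subordination_def q_def)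
  qed
  with dominant inj_on_one_minus_powr[OF \<open>c \<in> set_B\<close> \<open>c \<noteq> 0\<close>]
  have "best_dominant nonvanishing_normalized (\<lambda>r s z. 1 + K * (s / r)) h q"
    by (simp add: best_dominant_def q_def)
  moreover have "(\<lambda>z. 1 / (1 - z) powr c) = q"
    by (simp add: q_def powr_minus divide_inverse)
  moreover have "(\<lambda>z. 1 + A * (log_deriv_quot p f z - 1)) = G f" for f
    by (simp add: G_def)
  ultimately show ?thesis
    unfolding A_def[symmetric] K_def[symmetric] h_def[symmetric] q_def[symmetric]
    using part1 part2 by simp
qed

end
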